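(* Let $\mathsf{K}$ be a left distributive $\omega\mathsf{Cpo}^\vee$-enriched category and $J$ a subcategory containing all objects of $\mathsf{K}$. Then the functor $[!,\mathsf{K}]^J:[1,\mathsf{K}]^J\to[\mathbb{N},\mathsf{K}]^J$ admits a left 2-adjoint $\Sigma_!$.
   Context: $\omega\mathsf{Cpo}^\vee$-enriched: every hom-set is a poset with binary joins and suprema of ascending $\omega$-chains, and composition is monotone and preserves suprema of ascending $\omega$-chains in each variable. Left distributive: $h\circ(f\vee g)=h\circ f\vee h\circ g$. $[\mathbb{N},\mathsf{K}]^J$: objects are families $(\pi_n)_{n\in\mathbb{N}}$ of endomorphisms of a common object $X$ with $id_X\leq\pi_0$ and $\pi_m\circ\pi_n\leq\pi_{m+n}$ (lax functors from the monoid $(\mathbb{N},+,0)$); morphisms $\pi\to\pi'$ are arrows $f$ of $J$ with $f\circ\pi_n\leq\pi'_n\circ f$ for all $n$; order from $\mathsf{K}$. $[1,\mathsf{K}]^J$: objects are endomorphisms $\rho$ with $id\leq\rho$ and $\rho\circ\rho\leq\rho$; morphisms are $J$-arrows $f$ with $f\circ\rho\leq\rho'\circ f$. $[!,\mathsf{K}]^J$ sends $\rho$ to the constant sequence $(\rho)_{n\in\mathbb{N}}$ and $f$ to $f$. A left 2-adjoint is a hom-order preserving functor $F$ with poset isomorphisms $\mathsf{B}(FX,Y)\cong\mathsf{A}(X,UY)$ natural in $X,Y$, where $U$ is also hom-order preserving. *)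

theory Defs
  imports "HOL-Algebra.Lattice"
begin

section \<open>Poset-enriched categories\<close>

text \<open>
  Categories are given enriched-style: a set of objects and, for each pair of objects, a
  hom-poset \<open>Hom C X Y\<close>, an order structure in the sense of HOL-Algebra. Hom-sets of distinct pairs
  need not be disjoint, so composition is indexed by objects: \<open>Cmp C X Y Z g f\<close> is \<open>g \<circ> f\<close> for
  \<open>f : X \<rightarrow> Y\<close> and \<open>g : Y \<rightarrow> Z\<close>.
\<close>

record ('o, 'a) ocat =
  Ob :: "'o set"
  Hom :: "'o \<Rightarrow> 'o \<Rightarrow> 'a gorder"
  Idn :: "'o \<Rightarrow> 'a"
  Cmp :: "'o \<Rightarrow> 'o \<Rightarrow> 'o \<Rightarrow> 'a \<Rightarrow> 'a \<Rightarrow> 'a"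

abbreviation arr :: "('o, 'a) ocat \<Rightarrow> 'o \<Rightarrow> 'o \<Rightarrow> 'a set" where
  "arr C X Y \<equiv> carrier (Hom C X Y)"

locale poset_category =
  fixes C :: "('o, 'a) ocat"
  assumes hom_poset: "\<lbrakk>X \<in> Ob C; Y \<in> Ob C\<rbrakk> \<Longrightarrow> partial_order (Hom C X Y)"
    and id_closed: "X \<in> Ob C \<Longrightarrow> Idn C X \<in> arr C X X"
    and comp_closed: "\<lbrakk>X \<in> Ob C; Y \<in> Ob C; Z \<in> Ob C; f \<in> arr C X Y; g \<in> arr C Y Z\<rbrakk>
      \<Longrightarrow> Cmp C X Y Z g f \<in> arr C X Z"
    and id_left: "\<lbrakk>X \<in> Ob C; Y \<in> Ob C; f \<in> arr C X Y\<rbrakk> \<Longrightarrow> Cmp C X Y Y (Idn C Y) f = f"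
    and id_right: "\<lbrakk>X \<in> Ob C; Y \<in> Ob C; f \<in> arr C X Y\<rbrakk> \<Longrightarrow> Cmp C X X Y f (Idn C X) = f"
    and comp_assoc: "\<lbrakk>W \<in> Ob C; X \<in> Ob C; Y \<in> Ob C; Z \<in> Ob C;
        f \<in> arr C W X; g \<in> arr C X Y; h \<in> arr C Y Z\<rbrakk>
      \<Longrightarrow> Cmp C W Y Z h (Cmp C W X Y g f) = Cmp C W X Z (Cmp C X Y Z h g) f"
    and comp_mono: "\<lbrakk>X \<in> Ob C; Y \<in> Ob C; Z \<in> Ob C;
        f \<in> arr C X Y; f' \<in> arr C X Y; g \<in> arr C Y Z; g' \<in> arr C Y Z;
        f \<sqsubseteq>\<^bsub>Hom C X Y\<^esub> f'; g \<sqsubseteq>\<^bsub>Hom C Y Z\<^esub> g'\<rbrakk>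
      \<Longrightarrow> Cmp C X Y Z g f \<sqsubseteq>\<^bsub>Hom C X Z\<^esub> Cmp C X Y Z g' f'"

definition ascending_chain :: "('a, 'c) gorder_scheme \<Rightarrow> (nat \<Rightarrow> 'a) \<Rightarrow> bool" where
  "ascending_chain L c \<longleftrightarrow> (\<forall>n. c n \<in> carrier L) \<and> (\<forall>n. c n \<sqsubseteq>\<^bsub>L\<^esub> c (Suc n))"

locale omega_cpo_join_category = poset_category K
  for K :: "('o, 'a) ocat" +
  assumes binary_joins: "\<lbrakk>X \<in> Ob K; Y \<in> Ob K\<rbrakk> \<Longrightarrow> upper_semilattice (Hom K X Y)"
    and chain_sup: "\<lbrakk>X \<in> Ob K; Y \<in> Ob K; ascending_chain (Hom K X Y) c\<rbrakk>
      \<Longrightarrow> \<exists>s. is_lub (Hom K X Y) s (range c)"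
    and comp_chain_sup_right: "\<lbrakk>X \<in> Ob K; Y \<in> Ob K; Z \<in> Ob K; h \<in> arr K Y Z;
        ascending_chain (Hom K X Y) c; is_lub (Hom K X Y) s (range c)\<rbrakk>
      \<Longrightarrow> is_lub (Hom K X Z) (Cmp K X Y Z h s) (range (\<lambda>n. Cmp K X Y Z h (c n)))"
    and comp_chain_sup_left: "\<lbrakk>X \<in> Ob K; Y \<in> Ob K; Z \<in> Ob K; h \<in> arr K X Y;
        ascending_chain (Hom K Y Z) c; is_lub (Hom K Y Z) s (range c)\<rbrakk>
      \<Longrightarrow> is_lub (Hom K X Z) (Cmp K X Y Z s h) (range (\<lambda>n. Cmp K X Y Z (c n) h))"

locale left_distributive_omega_cpo_join_category = omega_cpo_join_category K
  for K :: "('o, 'a) ocat" +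
  assumes left_distrib: "\<lbrakk>X \<in> Ob K; Y \<in> Ob K; Z \<in> Ob K;
        f \<in> arr K X Y; g \<in> arr K X Y; h \<in> arr K Y Z\<rbrakk>
      \<Longrightarrow> Cmp K X Y Z h (f \<squnion>\<^bsub>Hom K X Y\<^esub> g)
        = Cmp K X Y Z h f \<squnion>\<^bsub>Hom K X Z\<^esub> Cmp K X Y Z h g"

text \<open>A subcategory with all objects, given by its hom-sets \<open>J X Y\<close>.\<close>

definition wide_subcategory :: "('o, 'a) ocat \<Rightarrow> ('o \<Rightarrow> 'o \<Rightarrow> 'a set) \<Rightarrow> bool" where
  "wide_subcategory K J \<longleftrightarrow>
     (\<forall>X\<in>Ob K. \<forall>Y\<in>Ob K. J X Y \<subseteq> arr K X Y) \<and>
     (\<forall>X\<in>Ob K. Idn K X \<in> J X X) \<and>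
     (\<forall>X\<in>Ob K. \<forall>Y\<in>Ob K. \<forall>Z\<in>Ob K. \<forall>f\<in>J X Y. \<forall>g\<in>J Y Z. Cmp K X Y Z g f \<in> J X Z)"


section \<open>2-functors and left 2-adjoints\<close>

record ('o, 'a, 'p, 'b) ofunctor =
  FOb :: "'o \<Rightarrow> 'p"
  FAr :: "'o \<Rightarrow> 'o \<Rightarrow> 'a \<Rightarrow> 'b"

definition poset_functor ::
    "('o, 'a) ocat \<Rightarrow> ('p, 'b) ocat \<Rightarrow> ('o, 'a, 'p, 'b) ofunctor \<Rightarrow> bool" where
  "poset_functor A B F \<longleftrightarrow>
     poset_category A \<and> poset_category B \<and>
     (\<forall>X\<in>Ob A. FOb F X \<in> Ob B) \<and>
     (\<forall>X\<in>Ob A. \<forall>Y\<in>Ob A. \<forall>f\<in>arr A X Y. FAr F X Y f \<in> arr B (FOb F X) (FOb F Y)) \<and>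
     (\<forall>X\<in>Ob A. FAr F X X (Idn A X) = Idn B (FOb F X)) \<and>
     (\<forall>X\<in>Ob A. \<forall>Y\<in>Ob A. \<forall>Z\<in>Ob A. \<forall>f\<in>arr A X Y. \<forall>g\<in>arr A Y Z.
        FAr F X Z (Cmp A X Y Z g f)
          = Cmp B (FOb F X) (FOb F Y) (FOb F Z) (FAr F Y Z g) (FAr F X Y f)) \<and>
     (\<forall>X\<in>Ob A. \<forall>Y\<in>Ob A. isotone (Hom A X Y) (Hom B (FOb F X) (FOb F Y)) (FAr F X Y))"

definition poset_iso ::
    "('a, 'c) gorder_scheme \<Rightarrow> ('b, 'd) gorder_scheme \<Rightarrow> ('a \<Rightarrow> 'b) \<Rightarrow> bool" where
  "poset_iso L M f \<longleftrightarrow> bij_betw f (carrier L) (carrier M) \<and> order_emb L M f"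

text \<open>\<open>F : A \<rightarrow> B\<close> is left 2-adjoint to \<open>U : B \<rightarrow> A\<close>.\<close>

definition left_2_adjoint ::
    "('o, 'a) ocat \<Rightarrow> ('p, 'b) ocat \<Rightarrow>
     ('o, 'a, 'p, 'b) ofunctor \<Rightarrow> ('p, 'b, 'o, 'a) ofunctor \<Rightarrow> bool" where
  "left_2_adjoint A B F U \<longleftrightarrow>
     poset_functor A B F \<and> poset_functor B A U \<and>
     (\<exists>\<phi>.
       (\<forall>X\<in>Ob A. \<forall>Y\<in>Ob B.
          poset_iso (Hom B (FOb F X) Y) (Hom A X (FOb U Y)) (\<phi> X Y)) \<and>
       (\<forall>X\<in>Ob A. \<forall>X'\<in>Ob A. \<forall>Y\<in>Ob B. \<forall>Y'\<in>Ob B.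
          \<forall>a\<in>arr A X' X. \<forall>b\<in>arr B Y Y'. \<forall>g\<in>arr B (FOb F X) Y.
            \<phi> X' Y' (Cmp B (FOb F X') Y Y' b (Cmp B (FOb F X') (FOb F X) Y g (FAr F X' X a)))
              = Cmp A X' (FOb U Y) (FOb U Y') (FAr U Y Y' b)
                  (Cmp A X' X (FOb U Y) (\<phi> X Y g) a)))"


section \<open>The categories of lax functors and the functor between them\<close>

text \<open>
  \<open>lax_nat_cat K J\<close> is $[\mathbb{N},\mathsf{K}]^J$. Since an arrow does not determine its hom-set,
  an object carries the underlying object of \<open>K\<close> along with the family of endomorphisms.
\<close>

definition lax_nat_cat ::
    "('o, 'a) ocat \<Rightarrow> ('o \<Rightarrow> 'o \<Rightarrow> 'a set) \<Rightarrow> ('o \<times> (nat \<Rightarrow> 'a), 'a) ocat" where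
  "lax_nat_cat K J = \<lparr>
     Ob = {(X, \<pi>). X \<in> Ob K \<and> (\<forall>n. \<pi> n \<in> arr K X X) \<and>
             Idn K X \<sqsubseteq>\<^bsub>Hom K X X\<^esub> \<pi> 0 \<and>
             (\<forall>m n. Cmp K X X X (\<pi> m) (\<pi> n) \<sqsubseteq>\<^bsub>Hom K X X\<^esub> \<pi> (m + n))},
     Hom = (\<lambda>(X, \<pi>) (Y, \<pi>'). (Hom K X Y)\<lparr>carrier :=
             {f \<in> J X Y. \<forall>n. Cmp K X X Y f (\<pi> n) \<sqsubseteq>\<^bsub>Hom K X Y\<^esub> Cmp K X Y Y (\<pi>' n) f}\<rparr>),
     Idn = (\<lambda>(X, _). Idn K X),
     Cmp = (\<lambda>(X, _) (Y, _) (Z, _). Cmp K X Y Z)\<rparr>"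

text \<open>\<open>lax_one_cat K J\<close> is $[1,\mathsf{K}]^J$.\<close>

definition lax_one_cat ::
    "('o, 'a) ocat \<Rightarrow> ('o \<Rightarrow> 'o \<Rightarrow> 'a set) \<Rightarrow> ('o \<times> 'a, 'a) ocat" where
  "lax_one_cat K J = \<lparr>
     Ob = {(X, \<rho>). X \<in> Ob K \<and> \<rho> \<in> arr K X X \<and>
             Idn K X \<sqsubseteq>\<^bsub>Hom K X X\<^esub> \<rho> \<and>
             Cmp K X X X \<rho> \<rho> \<sqsubseteq>\<^bsub>Hom K X X\<^esub> \<rho>},
     Hom = (\<lambda>(X, \<rho>) (Y, \<rho>'). (Hom K X Y)\<lparr>carrier :=
             {f \<in> J X Y. Cmp K X X Y f \<rho> \<sqsubseteq>\<^bsub>Hom K X Y\<^esub> Cmp K X Y Y \<rho>' f}\<rparr>),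
     Idn = (\<lambda>(X, _). Idn K X),
     Cmp = (\<lambda>(X, _) (Y, _) (Z, _). Cmp K X Y Z)\<rparr>"

text \<open>\<open>lax_bang\<close> is $[!,\mathsf{K}]^J$; its action does not mention \<open>K\<close> or \<open>J\<close>.\<close>

definition lax_bang :: "('o \<times> 'a, 'a, 'o \<times> (nat \<Rightarrow> 'a), 'a) ofunctor" where
  "lax_bang = \<lparr>FOb = (\<lambda>(X, \<rho>). (X, \<lambda>_. \<rho>)), FAr = (\<lambda>_ _ f. f)\<rparr>"

end

(* For a family \<pi> on X, let \<sigma> be the supremum of the finite joins \<pi> 0 \<squnion> ... \<squnion> \<pi> n, and let \<rho> be
   the supremum of the powers of \<sigma>.  The powers are needed because composition need not distribute
   over joins on the right, so that \<sigma> itself need not satisfy \<sigma> \<circ> \<sigma> \<sqsubseteq> \<sigma>.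
   Left distributivity and continuity give f \<circ> \<rho> \<sqsubseteq> \<rho>' \<circ> f whenever \<rho>' is lax idempotent and
   f \<circ> \<pi> n \<sqsubseteq> \<rho>' \<circ> f for all n; hence both sides of the adjunction have the same arrows, with the
   same order, and the hom-isomorphism is the identity. *)
theory Submission
  imports Defs
begin

section \<open>Sub-posets of hom-posets\<close>

lemma partial_order_carrier_update:
  assumes "partial_order L" "S \<subseteq> carrier L"
  shows "partial_order (L\<lparr>carrier := S\<rparr>)"
proof -
  interpret partial_order L by fact
  show ?thesis
  proof
    show "x .=\<^bsub>L\<lparr>carrier := S\<rparr>\<^esub> z"
      if "x .=\<^bsub>L\<lparr>carrier := S\<rparr>\<^esub> y" "y .=\<^bsub>L\<lparr>carrier := S\<rparr>\<^esub> z"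
        "x \<in> carrier (L\<lparr>carrier := S\<rparr>)" "y \<in> carrier (L\<lparr>carrier := S\<rparr>)"
        "z \<in> carrier (L\<lparr>carrier := S\<rparr>)" for x y z
      using that by (simp add: eq_is_equal)
    show "x \<sqsubseteq>\<^bsub>L\<lparr>carrier := S\<rparr>\<^esub> z"
      if "x \<sqsubseteq>\<^bsub>L\<lparr>carrier := S\<rparr>\<^esub> y" "y \<sqsubseteq>\<^bsub>L\<lparr>carrier := S\<rparr>\<^esub> z"
        "x \<in> carrier (L\<lparr>carrier := S\<rparr>)" "y \<in> carrier (L\<lparr>carrier := S\<rparr>)"
        "z \<in> carrier (L\<lparr>carrier := S\<rparr>)" for x y z
      using that assms(2) le_trans[of x y z] by auto
    show "x .=\<^bsub>L\<lparr>carrier := S\<rparr>\<^esub> y"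
      if "x \<sqsubseteq>\<^bsub>L\<lparr>carrier := S\<rparr>\<^esub> y" "y \<sqsubseteq>\<^bsub>L\<lparr>carrier := S\<rparr>\<^esub> x"
        "x \<in> carrier (L\<lparr>carrier := S\<rparr>)" "y \<in> carrier (L\<lparr>carrier := S\<rparr>)" for x y
      using that assms(2) le_antisym[of x y] by auto
  qed (use assms(2) in \<open>auto simp: eq_is_equal intro!: le_refl\<close>)
qed

section \<open>Lax squares and the categories of lax functors\<close>

context poset_category
begin

lemma hom_refl: "\<lbrakk>X \<in> Ob C; Y \<in> Ob C; f \<in> arr C X Y\<rbrakk> \<Longrightarrow> f \<sqsubseteq>\<^bsub>Hom C X Y\<^esub> f"
  by (meson hom_poset partial_order.axioms(1) weak_partial_order.le_refl)

lemma hom_trans: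
  "\<lbrakk>X \<in> Ob C; Y \<in> Ob C; f \<in> arr C X Y; g \<in> arr C X Y; h \<in> arr C X Y;
    f \<sqsubseteq>\<^bsub>Hom C X Y\<^esub> g; g \<sqsubseteq>\<^bsub>Hom C X Y\<^esub> h\<rbrakk> \<Longrightarrow> f \<sqsubseteq>\<^bsub>Hom C X Y\<^esub> h"
  by (meson hom_poset partial_order.axioms(1) weak_partial_order.le_trans)

lemma comp_mono_left:
  "\<lbrakk>X \<in> Ob C; Y \<in> Ob C; Z \<in> Ob C; f \<in> arr C X Y; g \<in> arr C Y Z; g' \<in> arr C Y Z;
    g \<sqsubseteq>\<^bsub>Hom C Y Z\<^esub> g'\<rbrakk> \<Longrightarrow> Cmp C X Y Z g f \<sqsubseteq>\<^bsub>Hom C X Z\<^esub> Cmp C X Y Z g' f"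
  by (simp add: comp_mono hom_refl)

lemma comp_mono_right:
  "\<lbrakk>X \<in> Ob C; Y \<in> Ob C; Z \<in> Ob C; f \<in> arr C X Y; f' \<in> arr C X Y; g \<in> arr C Y Z;
    f \<sqsubseteq>\<^bsub>Hom C X Y\<^esub> f'\<rbrakk> \<Longrightarrow> Cmp C X Y Z g f \<sqsubseteq>\<^bsub>Hom C X Z\<^esub> Cmp C X Y Z g f'"
  by (simp add: comp_mono hom_refl)

text \<open>Pasting of the two squares: \<open>g f p\<close> is below \<open>g q f\<close>, which is
  below \<open>r g f\<close>. This is what makes lax morphisms closed under composition.\<close>

lemma lax_square_comp:
  assumes ob: "X \<in> Ob C" "Y \<in> Ob C" "Z \<in> Ob C"
    and ar: "p \<in> arr C X X" "q \<in> arr C Y Y" "r \<in> arr C Z Z" "f \<in> arr C X Y" "g \<in> arr C Y Z"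
    and f: "Cmp C X X Y f p \<sqsubseteq>\<^bsub>Hom C X Y\<^esub> Cmp C X Y Y q f"
    and g: "Cmp C Y Y Z g q \<sqsubseteq>\<^bsub>Hom C Y Z\<^esub> Cmp C Y Z Z r g"
  shows "Cmp C X X Z (Cmp C X Y Z g f) p \<sqsubseteq>\<^bsub>Hom C X Z\<^esub> Cmp C X Z Z r (Cmp C X Y Z g f)"
proof -
  have "Cmp C X Y Z g (Cmp C X X Y f p) \<sqsubseteq>\<^bsub>Hom C X Z\<^esub> Cmp C X Y Z g (Cmp C X Y Y q f)"
    using ob ar f by (intro comp_mono_right comp_closed) auto
  moreover have "Cmp C X Y Z (Cmp C Y Y Z g q) f \<sqsubseteq>\<^bsub>Hom C X Z\<^esub> Cmp C X Y Z (Cmp C Y Z Z r g) f"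
    using ob ar g by (intro comp_mono_left comp_closed) auto
  ultimately show ?thesis
    using ob ar hom_trans[of X Z "Cmp C X X Z (Cmp C X Y Z g f) p"
        "Cmp C X Y Z (Cmp C Y Y Z g q) f" "Cmp C X Z Z r (Cmp C X Y Z g f)"]
    by (simp add: comp_assoc comp_closed)
qed

text \<open>Here \<open>u\<close> plays the role of a forgetful map on objects. Composition and
  order are those of \<open>C\<close>, so every axiom is inherited once the chosen sets of arrows
  contain the identities and are closed under composition. Both categories of lax functors arise
  this way with \<open>u = fst\<close>.\<close>

lemma poset_category_over:
  assumes ob: "\<And>P. P \<in> Ob D \<Longrightarrow> u P \<in> Ob C"
    and hom: "\<And>P Q. Hom D P Q = (Hom C (u P) (u Q))\<lparr>carrier := S P Q\<rparr>"
    and idn: "\<And>P. Idn D P = Idn C (u P)"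
    and cmp: "\<And>P Q R. Cmp D P Q R = Cmp C (u P) (u Q) (u R)"
    and sub: "\<And>P Q. \<lbrakk>P \<in> Ob D; Q \<in> Ob D\<rbrakk> \<Longrightarrow> S P Q \<subseteq> arr C (u P) (u Q)"
    and idS: "\<And>P. P \<in> Ob D \<Longrightarrow> Idn C (u P) \<in> S P P"
    and cmpS: "\<And>P Q R f g. \<lbrakk>P \<in> Ob D; Q \<in> Ob D; R \<in> Ob D; f \<in> S P Q; g \<in> S Q R\<rbrakk>
      \<Longrightarrow> Cmp C (u P) (u Q) (u R) g f \<in> S P R"
  shows "poset_category D"
proof (rule poset_category.intro)
  show "partial_order (Hom D P Q)" if "P \<in> Ob D" "Q \<in> Ob D" for P Q
    unfolding hom using that by (intro partial_order_carrier_update hom_poset ob sub)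
  show "Cmp D P R T h (Cmp D P Q R g f) = Cmp D P Q T (Cmp D Q R T h g) f"
    if "P \<in> Ob D" "Q \<in> Ob D" "R \<in> Ob D" "T \<in> Ob D"
      "f \<in> arr D P Q" "g \<in> arr D Q R" "h \<in> arr D R T" for P Q R T f g h
    using that sub[of P Q] sub[of Q R] sub[of R T]
    by (auto simp: hom cmp intro!: comp_assoc ob)
  show "Cmp D P Q R g f \<sqsubseteq>\<^bsub>Hom D P R\<^esub> Cmp D P Q R g' f'"
    if "P \<in> Ob D" "Q \<in> Ob D" "R \<in> Ob D" "f \<in> arr D P Q" "f' \<in> arr D P Q"
      "g \<in> arr D Q R" "g' \<in> arr D Q R" "f \<sqsubseteq>\<^bsub>Hom D P Q\<^esub> f'" "g \<sqsubseteq>\<^bsub>Hom D Q R\<^esub> g'"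
    for P Q R f f' g g'
    using that sub[of P Q] sub[of Q R] by (auto simp: hom cmp intro!: comp_mono ob)
  show "Cmp D P Q Q (Idn D Q) f = f" if "P \<in> Ob D" "Q \<in> Ob D" "f \<in> arr D P Q" for P Q f
    using that sub[of P Q] by (auto simp: hom cmp idn intro!: id_left ob)
  show "Cmp D P P Q f (Idn D P) = f" if "P \<in> Ob D" "Q \<in> Ob D" "f \<in> arr D P Q" for P Q f
    using that sub[of P Q] by (auto simp: hom cmp idn intro!: id_right ob)
qed (auto simp: hom cmp idn idS cmpS)

lemma poset_category_lax_nat_cat:
  assumes J: "wide_subcategory C J"
  shows "poset_category (lax_nat_cat C J)"
\<comment> \<open>With \<open>S\<close> the hom-sets of the category itself, the substantial
  condition is closure under composition: lax squares are pasted at each index \<open>n\<close>,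
  with middle endomorphism \<open>q n\<close>.\<close>
proof (rule poset_category_over[where u = fst and S = "\<lambda>P Q. arr (lax_nat_cat C J) P Q"])
  show "Cmp C (fst P) (fst Q) (fst R) g f \<in> arr (lax_nat_cat C J) P R"
    if "P \<in> Ob (lax_nat_cat C J)" "Q \<in> Ob (lax_nat_cat C J)" "R \<in> Ob (lax_nat_cat C J)"
      "f \<in> arr (lax_nat_cat C J) P Q" "g \<in> arr (lax_nat_cat C J) Q R" for P Q R f g
  proof -
    obtain X p Y q Z r where [simp]: "P = (X, p)" "Q = (Y, q)" "R = (Z, r)"
      by (metis surj_pair)
    have ob: "X \<in> Ob C" "Y \<in> Ob C" "Z \<in> Ob C" and fg: "f \<in> J X Y" "g \<in> J Y Z"
      using that by (auto simp: lax_nat_cat_def)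
    moreover have "f \<in> arr C X Y" "g \<in> arr C Y Z" "Cmp C X Y Z g f \<in> J X Z"
      using J ob fg unfolding wide_subcategory_def by blast+
    ultimately show ?thesis
      using that by (auto simp: lax_nat_cat_def intro!: lax_square_comp[of X Y Z _ "q _"])
  qed
qed (use J in \<open>auto simp: lax_nat_cat_def wide_subcategory_def id_left id_right hom_refl subset_iff\<close>)

lemma poset_category_lax_one_cat:
  assumes J: "wide_subcategory C J"
  shows "poset_category (lax_one_cat C J)"
proof (rule poset_category_over[where u = fst and S = "\<lambda>P Q. arr (lax_one_cat C J) P Q"])
  show "Cmp C (fst P) (fst Q) (fst R) g f \<in> arr (lax_one_cat C J) P R"
    if "P \<in> Ob (lax_one_cat C J)" "Q \<in> Ob (lax_one_cat C J)" "R \<in> Ob (lax_one_cat C J)"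
      "f \<in> arr (lax_one_cat C J) P Q" "g \<in> arr (lax_one_cat C J) Q R" for P Q R f g
  proof -
    obtain X p Y q Z r where [simp]: "P = (X, p)" "Q = (Y, q)" "R = (Z, r)"
      by (metis surj_pair)
    have ob: "X \<in> Ob C" "Y \<in> Ob C" "Z \<in> Ob C" and fg: "f \<in> J X Y" "g \<in> J Y Z"
      using that by (auto simp: lax_one_cat_def)
    moreover have "f \<in> arr C X Y" "g \<in> arr C Y Z" "Cmp C X Y Z g f \<in> J X Z"
      using J ob fg unfolding wide_subcategory_def by blast+
    ultimately show ?thesis
      using that by (auto simp: lax_one_cat_def intro!: lax_square_comp[of X Y Z p q r])
  qed
qed (use J in \<open>auto simp: lax_one_cat_def wide_subcategory_def id_left id_right hom_refl subset_iff\<close>)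

end

section \<open>Suprema of families and lax idempotent closures\<close>

context left_distributive_omega_cpo_join_category
begin

lemma is_lub_above:
  "\<lbrakk>X \<in> Ob K; Y \<in> Ob K; \<And>n. c n \<in> arr K X Y; is_lub (Hom K X Y) s (range c)\<rbrakk>
    \<Longrightarrow> c n \<sqsubseteq>\<^bsub>Hom K X Y\<^esub> s"
  by (auto intro: least_Upper_above)

lemma is_lub_below:
  "\<lbrakk>is_lub (Hom K X Y) s (range c); g \<in> arr K X Y; \<And>n. c n \<sqsubseteq>\<^bsub>Hom K X Y\<^esub> g\<rbrakk>
    \<Longrightarrow> s \<sqsubseteq>\<^bsub>Hom K X Y\<^esub> g"
  by (auto simp: least_def Upper_def)

text \<open>By continuity \<open>h s\<close> is the supremum of the \<open>h (c n)\<close>, so an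
  upper bound can be tested termwise.\<close>

lemma comp_lub_below:
  assumes "X \<in> Ob K" "Y \<in> Ob K" "Z \<in> Ob K" "h \<in> arr K Y Z"
    and "ascending_chain (Hom K X Y) c" "is_lub (Hom K X Y) s (range c)"
    and "g \<in> arr K X Z" "\<And>n. Cmp K X Y Z h (c n) \<sqsubseteq>\<^bsub>Hom K X Z\<^esub> g"
  shows "Cmp K X Y Z h s \<sqsubseteq>\<^bsub>Hom K X Z\<^esub> g"
  using assms by (blast intro: is_lub_below comp_chain_sup_right)

text \<open>The family need not ascend, so the chain of its finite joins takes its place. The last
  clause with \<open>h\<close> an identity says that \<open>s\<close> is the least upper bound; for
  general \<open>h\<close> it says that postcomposition preserves this supremum, which is the form
  needed for lax squares.\<close>

lemma ex_family_sup:
  fixes p :: "nat \<Rightarrow> 'a"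
  assumes X: "X \<in> Ob K" and Y: "Y \<in> Ob K" and p: "\<And>n. p n \<in> arr K X Y"
  shows "\<exists>s\<in>arr K X Y. (\<forall>n. p n \<sqsubseteq>\<^bsub>Hom K X Y\<^esub> s) \<and>
    (\<forall>Z\<in>Ob K. \<forall>h\<in>arr K Y Z. \<forall>g\<in>arr K X Z.
       (\<forall>n. Cmp K X Y Z h (p n) \<sqsubseteq>\<^bsub>Hom K X Z\<^esub> g) \<longrightarrow> Cmp K X Y Z h s \<sqsubseteq>\<^bsub>Hom K X Z\<^esub> g)"
proof -
  interpret XY: upper_semilattice "Hom K X Y"
    using X Y by (rule binary_joins)
  \<comment> \<open>No least element is assumed in the hom-posets, so the recursion starts at
    \<open>p 0\<close> and \<open>c n\<close> is the join of \<open>p 0\<close> up to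
    \<open>p n\<close> inclusive.\<close>
  define c where "c = rec_nat (p 0) (\<lambda>n j. j \<squnion>\<^bsub>Hom K X Y\<^esub> p (Suc n))"
  have c_simps [simp]: "c 0 = p 0" "c (Suc n) = c n \<squnion>\<^bsub>Hom K X Y\<^esub> p (Suc n)" for n
    by (simp_all add: c_def)
  have c: "c n \<in> arr K X Y" for n
    by (induction n) (auto simp: p)
  have pc: "p n \<sqsubseteq>\<^bsub>Hom K X Y\<^esub> c n" for n
    by (cases n) (auto simp: p c XY.join_right)
  have chain: "ascending_chain (Hom K X Y) c"
    by (auto simp: ascending_chain_def c p XY.join_left)
  obtain s where s: "is_lub (Hom K X Y) s (range c)"
    using chain_sup[OF X Y chain] by blast
  have sc: "s \<in> arr K X Y"
    using s by (rule least_closed)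
  have "p n \<sqsubseteq>\<^bsub>Hom K X Y\<^esub> s" for n
    using is_lub_above[OF X Y c s] hom_trans[OF X Y p c sc pc] by blast
  moreover have "Cmp K X Y Z h s \<sqsubseteq>\<^bsub>Hom K X Z\<^esub> g"
    if Z: "Z \<in> Ob K" and h: "h \<in> arr K Y Z" and g: "g \<in> arr K X Z"
      and le: "\<And>n. Cmp K X Y Z h (p n) \<sqsubseteq>\<^bsub>Hom K X Z\<^esub> g" for Z h g
  proof (rule comp_lub_below[OF X Y Z h chain s g])
    interpret XZ: upper_semilattice "Hom K X Z"
      using X Z by (rule binary_joins)
    \<comment> \<open>Left distributivity splits \<open>h (c (Suc n))\<close> into the join of
      \<open>h (c n)\<close> and \<open>h (p (Suc n))\<close>, both below \<open>g\<close>.\<close>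
    show "Cmp K X Y Z h (c n) \<sqsubseteq>\<^bsub>Hom K X Z\<^esub> g" for n
      by (induction n) (auto simp: left_distrib X Y Z h g c p le comp_closed intro!: XZ.join_le)
  qed
  ultimately show ?thesis using sc by blast
qed

text \<open>The last clause is the universal property of \<open>r\<close>: a lax square from
  \<open>s\<close> to a lax idempotent \<open>q\<close> is also one from \<open>r\<close> to
  \<open>q\<close>. For \<open>f\<close> an identity it says that \<open>r\<close> is the least lax
  idempotent above \<open>s\<close>.\<close>

lemma ex_lax_idempotent_closure:
  assumes X: "X \<in> Ob K" and s: "s \<in> arr K X X" and id_s: "Idn K X \<sqsubseteq>\<^bsub>Hom K X X\<^esub> s"
  shows "\<exists>r\<in>arr K X X. s \<sqsubseteq>\<^bsub>Hom K X X\<^esub> r \<and> Cmp K X X X r r \<sqsubseteq>\<^bsub>Hom K X X\<^esub> r \<and>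
    (\<forall>Y\<in>Ob K. \<forall>q\<in>arr K Y Y. \<forall>f\<in>arr K X Y.
       Idn K Y \<sqsubseteq>\<^bsub>Hom K Y Y\<^esub> q \<longrightarrow> Cmp K Y Y Y q q \<sqsubseteq>\<^bsub>Hom K Y Y\<^esub> q \<longrightarrow>
       Cmp K X X Y f s \<sqsubseteq>\<^bsub>Hom K X Y\<^esub> Cmp K X Y Y q f \<longrightarrow>
       Cmp K X X Y f r \<sqsubseteq>\<^bsub>Hom K X Y\<^esub> Cmp K X Y Y q f)"
proof -
  \<comment> \<open>These are the powers of \<open>s\<close>, with each new factor put on the left,
    where it can meet an arrow \<open>f\<close> composed after it. They ascend because the identity
    is below \<open>s\<close>.\<close>
  define t where "t n = (Cmp K X X X s ^^ n) (Idn K X)" for n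
  have t_simps [simp]: "t 0 = Idn K X" "t (Suc n) = Cmp K X X X s (t n)" for n
    by (simp_all add: t_def)
  have t: "t n \<in> arr K X X" for n
    by (induction n) (auto simp: X s id_closed comp_closed)
  have chain: "ascending_chain (Hom K X X) t"
    using comp_mono_left[OF X X X t id_closed[OF X] s id_s]
    by (auto simp: ascending_chain_def t X s id_left comp_closed simp del: t_simps(1))
  obtain r where r: "is_lub (Hom K X X) r (range t)"
    using chain_sup[OF X X chain] by blast
  have rc: "r \<in> arr K X X"
    using r by (rule least_closed)
  have tr: "t n \<sqsubseteq>\<^bsub>Hom K X X\<^esub> r" for n
    by (rule is_lub_above[OF X X t r])
  have sr: "s \<sqsubseteq>\<^bsub>Hom K X X\<^esub> r"
    using tr[of 1] by (simp add: id_right X s)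
  \<comment> \<open>Termwise, \<open>s (t n)\<close> is the next power
    \<open>t (Suc n)\<close>.\<close>
  have s_r: "Cmp K X X X s r \<sqsubseteq>\<^bsub>Hom K X X\<^esub> r"
    using tr[of "Suc _"] by (intro comp_lub_below[OF X X X s chain r rc]) simp
  \<comment> \<open>The two factors of \<open>r r\<close> are treated in turn: the right one is kept
    fixed while powers of \<open>s\<close> are absorbed one factor at a time by \<open>s r\<close>
    below \<open>r\<close>, and continuity in the left factor then yields \<open>rr\<close>.\<close>
  have "Cmp K X X X (t n) r \<sqsubseteq>\<^bsub>Hom K X X\<^esub> r" for n
  proof (induction n)
    case (Suc n)
    have "Cmp K X X X s (Cmp K X X X (t n) r) \<sqsubseteq>\<^bsub>Hom K X X\<^esub> Cmp K X X X s r"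
      using Suc by (intro comp_mono_right) (auto simp: X s t rc comp_closed)
    then show ?case
      using hom_trans[OF X X _ _ rc _ s_r] by (simp add: comp_assoc X s t rc comp_closed)
  qed (simp add: X rc id_left hom_refl)
  then have rr: "Cmp K X X X r r \<sqsubseteq>\<^bsub>Hom K X X\<^esub> r"
    using is_lub_below[OF comp_chain_sup_left[OF X X X rc chain r] rc] by blast
  have "Cmp K X X Y f r \<sqsubseteq>\<^bsub>Hom K X Y\<^esub> Cmp K X Y Y q f"
    if Y: "Y \<in> Ob K" and q: "q \<in> arr K Y Y" and f: "f \<in> arr K X Y"
      and id_q: "Idn K Y \<sqsubseteq>\<^bsub>Hom K Y Y\<^esub> q" and qq: "Cmp K Y Y Y q q \<sqsubseteq>\<^bsub>Hom K Y Y\<^esub> q"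
      and fs: "Cmp K X X Y f s \<sqsubseteq>\<^bsub>Hom K X Y\<^esub> Cmp K X Y Y q f" for Y q f
  proof (rule comp_lub_below[OF X X Y f chain r])
    show qf: "Cmp K X Y Y q f \<in> arr K X Y"
      by (simp add: X Y q f comp_closed)
    \<comment> \<open>The base case uses that the identity is below \<open>q\<close>. In the step,
      \<open>f s (t n)\<close> is below \<open>q f (t n)\<close>, hence below \<open>q q f\<close>
      by induction, hence below \<open>q f\<close>.\<close>
    show "Cmp K X X Y f (t n) \<sqsubseteq>\<^bsub>Hom K X Y\<^esub> Cmp K X Y Y q f" for n
    proof (induction n)
      case 0
      show ?case
        using comp_mono_left[OF X Y Y f id_closed[OF Y] q id_q] by (simp add: X Y f id_left id_right)
    next
      case (Suc n)
      have "Cmp K X X Y (Cmp K X X Y f s) (t n) \<sqsubseteq>\<^bsub>Hom K X Y\<^esub> Cmp K X X Y (Cmp K X Y Y q f) (t n)"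
        using fs by (intro comp_mono_left) (auto simp: X Y f s t qf comp_closed)
      moreover have "Cmp K X Y Y q (Cmp K X X Y f (t n)) \<sqsubseteq>\<^bsub>Hom K X Y\<^esub> Cmp K X Y Y q (Cmp K X Y Y q f)"
        using Suc by (intro comp_mono_right) (auto simp: X Y f q t qf comp_closed)
      moreover have "Cmp K X Y Y (Cmp K Y Y Y q q) f \<sqsubseteq>\<^bsub>Hom K X Y\<^esub> Cmp K X Y Y q f"
        using qq by (intro comp_mono_left) (auto simp: X Y f q comp_closed)
      ultimately show ?case
        using hom_trans[OF X Y, of "Cmp K X X Y f (t (Suc n))"
            "Cmp K X Y Y q (Cmp K X X Y f (t n))" "Cmp K X Y Y q (Cmp K X Y Y q f)"]
          hom_trans[OF X Y, of "Cmp K X X Y f (t (Suc n))"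
            "Cmp K X Y Y q (Cmp K X Y Y q f)" "Cmp K X Y Y q f"]
        by (simp add: comp_assoc comp_closed X Y f q s t)
    qed
  qed
  with rc sr rr show ?thesis by blast
qed

text \<open>Here \<open>r\<close> is the lax idempotent closure of the supremum \<open>s\<close> of
  the family. Equality of the hom-sets is the universal property of a reflection; the bound
  \<open>p n\<close> below \<open>r\<close> makes the identity of \<open>X\<close> its unit.\<close>

lemma ex_lax_reflection:
  assumes J: "wide_subcategory K J" and P: "(X, p) \<in> Ob (lax_nat_cat K J)"
  shows "\<exists>r. (X, r) \<in> Ob (lax_one_cat K J) \<and>
    (\<forall>Q\<in>Ob (lax_one_cat K J).
       arr (lax_one_cat K J) (X, r) Q = arr (lax_nat_cat K J) (X, p) (FOb lax_bang Q)) \<and>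
    (\<forall>n. p n \<sqsubseteq>\<^bsub>Hom K X X\<^esub> r)"
proof -
  have X: "X \<in> Ob K" and p: "p n \<in> arr K X X" and id_p: "Idn K X \<sqsubseteq>\<^bsub>Hom K X X\<^esub> p 0" for n
    using P by (auto simp: lax_nat_cat_def)
  obtain s where s: "s \<in> arr K X X" and ps: "\<And>n. p n \<sqsubseteq>\<^bsub>Hom K X X\<^esub> s"
    and s_least: "\<And>Y h g. \<lbrakk>Y \<in> Ob K; h \<in> arr K X Y; g \<in> arr K X Y;
      \<And>n. Cmp K X X Y h (p n) \<sqsubseteq>\<^bsub>Hom K X Y\<^esub> g\<rbrakk> \<Longrightarrow> Cmp K X X Y h s \<sqsubseteq>\<^bsub>Hom K X Y\<^esub> g"
    using ex_family_sup[of X X p, OF X X p] by metis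
  have id_s: "Idn K X \<sqsubseteq>\<^bsub>Hom K X X\<^esub> s"
    using hom_trans[OF X X id_closed[OF X] p s id_p ps] .
  obtain r where r: "r \<in> arr K X X" and sr: "s \<sqsubseteq>\<^bsub>Hom K X X\<^esub> r"
    and rr: "Cmp K X X X r r \<sqsubseteq>\<^bsub>Hom K X X\<^esub> r"
    and r_least: "\<And>Y q f. \<lbrakk>Y \<in> Ob K; q \<in> arr K Y Y; f \<in> arr K X Y;
      Idn K Y \<sqsubseteq>\<^bsub>Hom K Y Y\<^esub> q; Cmp K Y Y Y q q \<sqsubseteq>\<^bsub>Hom K Y Y\<^esub> q;
      Cmp K X X Y f s \<sqsubseteq>\<^bsub>Hom K X Y\<^esub> Cmp K X Y Y q f\<rbrakk>
      \<Longrightarrow> Cmp K X X Y f r \<sqsubseteq>\<^bsub>Hom K X Y\<^esub> Cmp K X Y Y q f"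
    using ex_lax_idempotent_closure[OF X s id_s] by metis
  have pr: "p n \<sqsubseteq>\<^bsub>Hom K X X\<^esub> r" for n
    using hom_trans[OF X X p s r ps sr] .
  have "Idn K X \<sqsubseteq>\<^bsub>Hom K X X\<^esub> r"
    using hom_trans[OF X X id_closed[OF X] s r id_s sr] .
  then have "(X, r) \<in> Ob (lax_one_cat K J)"
    using X r rr by (simp add: lax_one_cat_def)
  moreover have "arr (lax_one_cat K J) (X, r) (Y, q) = arr (lax_nat_cat K J) (X, p) (Y, \<lambda>_. q)"
    if Q: "(Y, q) \<in> Ob (lax_one_cat K J)" for Y q
  proof -
    have Y: "Y \<in> Ob K" and q: "q \<in> arr K Y Y" and id_q: "Idn K Y \<sqsubseteq>\<^bsub>Hom K Y Y\<^esub> q"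
      and qq: "Cmp K Y Y Y q q \<sqsubseteq>\<^bsub>Hom K Y Y\<^esub> q"
      using Q by (auto simp: lax_one_cat_def)
    \<comment> \<open>From left to right, \<open>f (p n)\<close> is below \<open>f r\<close> by
      monotonicity. Conversely, the bounds pass from the \<open>p n\<close> to \<open>s\<close> by
      \<open>s_least\<close>, and from \<open>s\<close> to \<open>r\<close> by
      \<open>r_least\<close>.\<close>
    have "Cmp K X X Y f r \<sqsubseteq>\<^bsub>Hom K X Y\<^esub> Cmp K X Y Y q f \<longleftrightarrow>
        (\<forall>n. Cmp K X X Y f (p n) \<sqsubseteq>\<^bsub>Hom K X Y\<^esub> Cmp K X Y Y q f)" if "f \<in> J X Y" for f
    proof -
      have f: "f \<in> arr K X Y"
        using J X Y that by (auto simp: wide_subcategory_def)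
      have qf: "Cmp K X Y Y q f \<in> arr K X Y"
        by (simp add: X Y q f comp_closed)
      show ?thesis
        using r_least[OF Y q f id_q qq s_least[OF Y f qf]]
          hom_trans[OF X Y _ _ qf comp_mono_right[OF X X Y p r f pr]]
        by (auto simp: comp_closed X Y f p r)
    qed
    then show ?thesis
      by (auto simp: lax_one_cat_def lax_nat_cat_def)
  qed
  ultimately show ?thesis
    using pr by (auto simp: lax_bang_def)
qed

end

section \<open>The left 2-adjoint\<close>

theorem theorem3p18:
  fixes K :: "('o, 'a) ocat"
    and J :: "'o \<Rightarrow> 'o \<Rightarrow> 'a set"
  assumes "left_distributive_omega_cpo_join_category K"
    and "wide_subcategory K J"
  shows "\<exists>\<Sigma>. left_2_adjoint (lax_nat_cat K J) (lax_one_cat K J) \<Sigma> lax_bang"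
proof -
  interpret left_distributive_omega_cpo_join_category K by fact
  note J = assms(2)
  let ?N = "lax_nat_cat K J" and ?O = "lax_one_cat K J"
  obtain r where r: "\<And>X p. (X, p) \<in> Ob ?N \<Longrightarrow> (X, r X p) \<in> Ob ?O"
    and r_arr: "\<And>X p Q. \<lbrakk>(X, p) \<in> Ob ?N; Q \<in> Ob ?O\<rbrakk>
      \<Longrightarrow> arr ?O (X, r X p) Q = arr ?N (X, p) (FOb lax_bang Q)"
    and pr: "\<And>X p n. (X, p) \<in> Ob ?N \<Longrightarrow> p n \<sqsubseteq>\<^bsub>Hom K X X\<^esub> r X p"
    using ex_lax_reflection[OF J] by metis
  \<comment> \<open>Arrows can be left unchanged because the unit is carried by identities of
    \<open>K\<close>.\<close>
  define \<Sigma> :: "('o \<times> (nat \<Rightarrow> 'a), 'a, 'o \<times> 'a, 'a) ofunctor"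
    where "\<Sigma> = \<lparr>FOb = \<lambda>(X, p). (X, r X p), FAr = \<lambda>_ _ f. f\<rparr>"
  have N: "poset_category ?N" and O: "poset_category ?O"
    using J by (rule poset_category_lax_nat_cat poset_category_lax_one_cat)+
  have isotone_id: "isotone L M (\<lambda>f. f)"
    if "weak_partial_order L" "weak_partial_order M" "le L = le M" for L M :: "'a gorder"
    using that by (simp add: isotone_def)
  have weak: "weak_partial_order (Hom D P Q)"
    if "poset_category D" "P \<in> Ob D" "Q \<in> Ob D" for D :: "('p, 'a) ocat" and P Q
    by (rule partial_order.axioms(1)[OF poset_category.hom_poset[OF that]])
  have bang_ob: "FOb lax_bang Q \<in> Ob ?N" if "Q \<in> Ob ?O" for Q
    using that by (auto simp: lax_bang_def lax_one_cat_def lax_nat_cat_def)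
  have \<Sigma>_ob: "FOb \<Sigma> P \<in> Ob ?O" if "P \<in> Ob ?N" for P
    using that r by (cases P) (simp add: \<Sigma>_def)
  have \<Sigma>_arr: "arr ?O (FOb \<Sigma> P) Q = arr ?N P (FOb lax_bang Q)" if "P \<in> Ob ?N" "Q \<in> Ob ?O" for P Q
    using that r_arr by (cases P) (simp add: \<Sigma>_def)
  \<comment> \<open>Well-definedness of the functor on arrows: composing \<open>f\<close> with the
    unit at \<open>Q\<close> gives an arrow from \<open>P\<close> to a constant sequence, and
    \<open>\<Sigma>_arr\<close> reads it as an arrow between the closures. Its underlying arrow is
    still \<open>f\<close>.\<close>
  have unit: "arr ?N P Q \<subseteq> arr ?O (FOb \<Sigma> P) (FOb \<Sigma> Q)" if P: "P \<in> Ob ?N" and Q: "Q \<in> Ob ?N" for P Q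
  proof
    fix f assume f: "f \<in> arr ?N P Q"
    obtain X p Y q where [simp]: "P = (X, p)" "Q = (Y, q)"
      by fastforce
    \<comment> \<open>The lax square for the identity at index \<open>n\<close> is the inequality
      \<open>q n\<close> below \<open>r Y q\<close>.\<close>
    have "Idn K Y \<in> arr ?N Q (FOb lax_bang (FOb \<Sigma> Q))"
      using J Q r[of Y q] pr[of Y q]
      by (auto simp: lax_nat_cat_def lax_one_cat_def lax_bang_def \<Sigma>_def wide_subcategory_def id_left id_right)
    then have "Cmp ?N P Q (FOb lax_bang (FOb \<Sigma> Q)) (Idn K Y) f \<in> arr ?N P (FOb lax_bang (FOb \<Sigma> Q))"
      using poset_category.comp_closed[OF N P Q bang_ob[OF \<Sigma>_ob[OF Q]] f] by blast
    moreover have "Cmp ?N P Q (FOb lax_bang (FOb \<Sigma> Q)) (Idn K Y) f = f"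
    proof -
      have ob: "X \<in> Ob K" "Y \<in> Ob K" and "f \<in> J X Y"
        using P Q f by (auto simp: lax_nat_cat_def)
      then have "f \<in> arr K X Y"
        using J unfolding wide_subcategory_def by blast
      then show ?thesis
        using ob by (simp add: lax_nat_cat_def lax_bang_def \<Sigma>_def id_left)
    qed
    ultimately show "f \<in> arr ?O (FOb \<Sigma> P) (FOb \<Sigma> Q)"
      using \<Sigma>_arr[OF P \<Sigma>_ob[OF Q]] by simp
  qed
  have "poset_functor ?N ?O \<Sigma>"
    unfolding poset_functor_def
  proof (intro conjI ballI)
    show "isotone (Hom ?N P Q) (Hom ?O (FOb \<Sigma> P) (FOb \<Sigma> Q)) (FAr \<Sigma> P Q)"
      if "P \<in> Ob ?N" "Q \<in> Ob ?N" for P Q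
    proof -
      have "isotone (Hom ?N P Q) (Hom ?O (FOb \<Sigma> P) (FOb \<Sigma> Q)) (\<lambda>f. f)"
        using that weak[OF N] weak[OF O] \<Sigma>_ob
        by (intro isotone_id) (auto simp: \<Sigma>_def lax_nat_cat_def lax_one_cat_def split: prod.splits)
      then show ?thesis by (simp add: \<Sigma>_def)
    qed
    show "FAr \<Sigma> P Q f \<in> arr ?O (FOb \<Sigma> P) (FOb \<Sigma> Q)"
      if "P \<in> Ob ?N" "Q \<in> Ob ?N" "f \<in> arr ?N P Q" for P Q f
      using subsetD[OF unit[OF that(1,2)] that(3)] by (simp add: \<Sigma>_def)
  qed (use N O \<Sigma>_ob in \<open>auto simp: \<Sigma>_def lax_nat_cat_def lax_one_cat_def\<close>)
  moreover have "poset_functor ?O ?N lax_bang"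
    unfolding poset_functor_def
  proof (intro conjI ballI)
    show "isotone (Hom ?O P Q) (Hom ?N (FOb lax_bang P) (FOb lax_bang Q)) (FAr lax_bang P Q)"
      if "P \<in> Ob ?O" "Q \<in> Ob ?O" for P Q
    proof -
      have "isotone (Hom ?O P Q) (Hom ?N (FOb lax_bang P) (FOb lax_bang Q)) (\<lambda>f. f)"
        using that weak[OF N] weak[OF O] bang_ob
        by (intro isotone_id) (auto simp: lax_bang_def lax_nat_cat_def lax_one_cat_def split: prod.splits)
      then show ?thesis by (simp add: lax_bang_def)
    qed
  qed (use N O bang_ob in \<open>auto simp: lax_bang_def lax_nat_cat_def lax_one_cat_def\<close>)
  moreover have "poset_iso (Hom ?O (FOb \<Sigma> P) Q) (Hom ?N P (FOb lax_bang Q)) (\<lambda>f. f)"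
    if "P \<in> Ob ?N" "Q \<in> Ob ?O" for P Q
  proof -
    \<comment> \<open>Both hom-posets carry the order of the same hom-poset of \<open>K\<close>; the
      carriers agree by \<open>\<Sigma>_arr\<close>.\<close>
    have "le (Hom ?O (FOb \<Sigma> P) Q) = le (Hom ?N P (FOb lax_bang Q))"
      by (auto simp: \<Sigma>_def lax_bang_def lax_nat_cat_def lax_one_cat_def split: prod.splits)
    then show ?thesis
      using \<Sigma>_arr[OF that] weak[OF O \<Sigma>_ob[OF that(1)] that(2)] weak[OF N that(1) bang_ob[OF that(2)]]
      by (simp add: poset_iso_def order_emb_def bij_betw_def)
  qed
  \<comment> \<open>Naturality: both functors and the hom-isomorphism fix arrows, so each side
    unfolds to the same composite in \<open>K\<close>.\<close>
  moreover have "Cmp ?O (FOb \<Sigma> P') Q Q' b (Cmp ?O (FOb \<Sigma> P') (FOb \<Sigma> P) Q g (FAr \<Sigma> P' P a)) =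
      Cmp ?N P' (FOb lax_bang Q) (FOb lax_bang Q') (FAr lax_bang Q Q' b)
        (Cmp ?N P' P (FOb lax_bang Q) g a)" for P P' Q Q' a b g
    by (auto simp: \<Sigma>_def lax_bang_def lax_nat_cat_def lax_one_cat_def split: prod.splits)
  ultimately have "left_2_adjoint ?N ?O \<Sigma> lax_bang"
    unfolding left_2_adjoint_def by (intro conjI exI[of _ "\<lambda>_ _ f. f"] ballI)
  then show ?thesis ..
qed

end
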